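(* Let $(M,g,J,\omega)$ be an almost Kähler manifold. Assume that the Hermitian curvature tensor $\widetilde R$ associated to $(g,J)$ satisfies the first Bianchi identity $$\widetilde{R}(X,Y,Z,\cdot)+\widetilde{R}(Y,Z,X,\cdot)+\widetilde{R}(Z,X,Y,\cdot)=0\quad\text{for every }X,Y,Z\in\Gamma(TM).$$ Then $(M,g,J,\omega)$ is a Kähler manifold.
   Context: An almost Hermitian manifold $(M,g,J,\omega)$ is a smooth manifold with an almost complex structure $J$, a Riemannian metric $g$ preserved by $J$, and the 2-form $\omega(\cdot,\cdot)=g(J\cdot,\cdot)$. It is almost Kähler if $d\omega=0$, and Kähler if moreover $J$ is integrable, i.e. the Nijenhuis tensor $N(X,Y)=[JX,JY]-J[JX,Y]-J[X,JY]-[X,Y]$ vanishes. Let $\nabla$ be the Levi-Civita connection of $g$. The canonical connection $\widetilde\nabla$ of $(g,J)$ is the unique linear connection with $\widetilde\nabla g=0$, $\widetilde\nabla J=0$ and vanishing $(1,1)$-part of the torsion; for almost Kähler (more generally, whenever $(d\omega)^{1,2}=0$) it is $\widetilde\nabla_XY=\nabla_XY-\frac12J(\nabla_XJ)Y$. The Hermitian curvature tensor is $\widetilde R(X,Y,Z,W)=g(\widetilde\nabla_X\widetilde\nabla_YZ-\widetilde\nabla_Y\widetilde\nabla_XZ-\widetilde\nabla_{[X,Y]}Z,W)$. *)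

theory Defs
  imports "HOL-Analysis.Analysis"
begin

section \<open>Smooth maps between Euclidean spaces\<close>

text \<open>Used only for open \<open>S\<close>: \<open>times_differentiable_on n S f\<close> says that all iterated directional
  derivatives of \<open>f\<close> of order at most \<open>n\<close> exist and are continuous on \<open>S\<close>.\<close>

primrec times_differentiable_on ::
  "nat \<Rightarrow> 'a::euclidean_space set \<Rightarrow> ('a \<Rightarrow> 'b::euclidean_space) \<Rightarrow> bool" where
  "times_differentiable_on 0 S f \<longleftrightarrow> continuous_on S f"
| "times_differentiable_on (Suc n) S f \<longleftrightarrow>
     (\<forall>x\<in>S. f differentiable (at x)) \<and>
     (\<forall>v. times_differentiable_on n S (\<lambda>x. frechet_derivative f (at x) v))"

definition smooth_on :: "'a::euclidean_space set \<Rightarrow> ('a \<Rightarrow> 'b::euclidean_space) \<Rightarrow> bool" where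
  "smooth_on S f \<longleftrightarrow> (\<forall>n. times_differentiable_on n S f)"

section \<open>Smooth manifolds\<close>

text \<open>A chart is a domain together with a map which is only relevant on this domain. A smooth manifold
  is a second countable Hausdorff type \<open>'m\<close> with an atlas \<open>A\<close> of charts into \<open>'e\<close>. The atlas need
  not be maximal.\<close>

type_synonym ('m, 'e) chart = "'m set \<times> ('m \<Rightarrow> 'e)"

definition chart_image :: "('m, 'e) chart \<Rightarrow> 'e set" where
  "chart_image c = snd c ` fst c"

definition chart_inv :: "('m, 'e) chart \<Rightarrow> 'e \<Rightarrow> 'm" where
  "chart_inv c = inv_into (fst c) (snd c)"

definition is_chart :: "('m::topological_space, 'e::euclidean_space) chart \<Rightarrow> bool" where
  "is_chart c \<longleftrightarrow> open (fst c) \<and> open (chart_image c) \<and>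
     homeomorphism (fst c) (chart_image c) (snd c) (chart_inv c)"

definition smooth_manifold ::
  "('m::{t2_space, second_countable_topology}, 'e::euclidean_space) chart set \<Rightarrow> bool" where
  "smooth_manifold A \<longleftrightarrow>
     (\<forall>c\<in>A. is_chart c) \<and> (\<Union>c\<in>A. fst c) = UNIV \<and>
     (\<forall>c\<in>A. \<forall>d\<in>A. smooth_on (snd c ` (fst c \<inter> fst d)) (snd d \<circ> chart_inv c))"

text \<open>For each point \<open>p\<close> one chart around \<open>p\<close> is singled out, and the tangent space at \<open>p\<close> is
  identified with \<open>'e\<close> by means of the coordinates of this chart. So a vector field is a
  function \<open>X :: 'm \<Rightarrow> 'e\<close>, whose value \<open>X p\<close> is the coordinate vector of the tangent vector at \<open>p\<close>
  with respect to \<open>chart_at A p\<close>. As \<open>chart_at A p\<close> depends on \<open>p\<close> in an arbitrary way, smoothness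
  and derivatives always refer to the representation \<open>local_rep A c X\<close> of \<open>X\<close> in one fixed
  chart \<open>c\<close>, obtained from \<open>X\<close> by the differential of the coordinate change.\<close>

definition chart_at :: "('m, 'e) chart set \<Rightarrow> 'm \<Rightarrow> ('m, 'e) chart" where
  "chart_at A p = (SOME c. c \<in> A \<and> p \<in> fst c)"

definition tangent_coords ::
  "('m, 'e::euclidean_space) chart set \<Rightarrow> ('m, 'e) chart \<Rightarrow> 'm \<Rightarrow> 'e \<Rightarrow> 'e" where
  "tangent_coords A c p =
     frechet_derivative (snd c \<circ> chart_inv (chart_at A p)) (at (snd (chart_at A p) p))"

definition local_rep ::
  "('m, 'e::euclidean_space) chart set \<Rightarrow> ('m, 'e) chart \<Rightarrow> ('m \<Rightarrow> 'e) \<Rightarrow> 'e \<Rightarrow> 'e" where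
  "local_rep A c X = (\<lambda>x. tangent_coords A c (chart_inv c x) (X (chart_inv c x)))"

definition smooth_functions :: "('m, 'e::euclidean_space) chart set \<Rightarrow> ('m \<Rightarrow> real) set" where
  "smooth_functions A = {f. \<forall>c\<in>A. smooth_on (chart_image c) (f \<circ> chart_inv c)}"

definition vector_fields :: "('m, 'e::euclidean_space) chart set \<Rightarrow> ('m \<Rightarrow> 'e) set" where
  "vector_fields A = {X. \<forall>c\<in>A. smooth_on (chart_image c) (local_rep A c X)}"

definition vf_deriv ::
  "('m, 'e::euclidean_space) chart set \<Rightarrow> ('m \<Rightarrow> 'e) \<Rightarrow> ('m \<Rightarrow> real) \<Rightarrow> 'm \<Rightarrow> real" where
  "vf_deriv A X f = (\<lambda>p. let c = chart_at A p in
     frechet_derivative (f \<circ> chart_inv c) (at (snd c p)) (X p))"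

text \<open>In coordinates, \<open>[X, Y] = DY(X) - DX(Y)\<close>; then \<open>[X, Y] f = X (Y f) - Y (X f)\<close>.\<close>

definition lie_bracket ::
  "('m, 'e::euclidean_space) chart set \<Rightarrow> ('m \<Rightarrow> 'e) \<Rightarrow> ('m \<Rightarrow> 'e) \<Rightarrow> 'm \<Rightarrow> 'e" where
  "lie_bracket A X Y = (\<lambda>p. let c = chart_at A p in
     frechet_derivative (local_rep A c Y) (at (snd c p)) (X p)
     - frechet_derivative (local_rep A c X) (at (snd c p)) (Y p))"

section \<open>Tensor fields\<close>

definition riemannian_metric ::
  "('m, 'e::euclidean_space) chart set \<Rightarrow> ('m \<Rightarrow> 'e \<Rightarrow> 'e \<Rightarrow> real) \<Rightarrow> bool" where
  "riemannian_metric A g \<longleftrightarrow>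
     (\<forall>p. bilinear (g p)) \<and> (\<forall>p u v. g p u v = g p v u) \<and> (\<forall>p u. u \<noteq> 0 \<longrightarrow> g p u u > 0) \<and>
     (\<forall>X\<in>vector_fields A. \<forall>Y\<in>vector_fields A. (\<lambda>p. g p (X p) (Y p)) \<in> smooth_functions A)"

definition endo_app :: "('m \<Rightarrow> 'e \<Rightarrow> 'e) \<Rightarrow> ('m \<Rightarrow> 'e) \<Rightarrow> 'm \<Rightarrow> 'e" where
  "endo_app J X = (\<lambda>p. J p (X p))"

definition almost_complex_structure ::
  "('m, 'e::euclidean_space) chart set \<Rightarrow> ('m \<Rightarrow> 'e \<Rightarrow> 'e) \<Rightarrow> bool" where
  "almost_complex_structure A J \<longleftrightarrow>
     (\<forall>p. linear (J p)) \<and> (\<forall>p u. J p (J p u) = - u) \<and>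
     (\<forall>X\<in>vector_fields A. endo_app J X \<in> vector_fields A)"

definition ext_deriv2 ::
  "('m, 'e::euclidean_space) chart set \<Rightarrow> ('m \<Rightarrow> 'e \<Rightarrow> 'e \<Rightarrow> real) \<Rightarrow>
   ('m \<Rightarrow> 'e) \<Rightarrow> ('m \<Rightarrow> 'e) \<Rightarrow> ('m \<Rightarrow> 'e) \<Rightarrow> 'm \<Rightarrow> real" where
  "ext_deriv2 A w X Y Z = (\<lambda>p.
       vf_deriv A X (\<lambda>q. w q (Y q) (Z q)) p
     - vf_deriv A Y (\<lambda>q. w q (X q) (Z q)) p
     + vf_deriv A Z (\<lambda>q. w q (X q) (Y q)) p
     - w p (lie_bracket A X Y p) (Z p)
     + w p (lie_bracket A X Z p) (Y p)
     - w p (lie_bracket A Y Z p) (X p))"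

section \<open>Almost Hermitian, almost Kaehler and Kaehler manifolds\<close>

definition almost_hermitian ::
  "('m::{t2_space, second_countable_topology}, 'e::euclidean_space) chart set \<Rightarrow>
   ('m \<Rightarrow> 'e \<Rightarrow> 'e \<Rightarrow> real) \<Rightarrow> ('m \<Rightarrow> 'e \<Rightarrow> 'e) \<Rightarrow> ('m \<Rightarrow> 'e \<Rightarrow> 'e \<Rightarrow> real) \<Rightarrow> bool" where
  "almost_hermitian A g J w \<longleftrightarrow>
     smooth_manifold A \<and> riemannian_metric A g \<and> almost_complex_structure A J \<and>
     (\<forall>p u v. g p (J p u) (J p v) = g p u v) \<and>
     (\<forall>p u v. w p u v = g p (J p u) v)"

definition almost_kaehler ::
  "('m::{t2_space, second_countable_topology}, 'e::euclidean_space) chart set \<Rightarrow>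
   ('m \<Rightarrow> 'e \<Rightarrow> 'e \<Rightarrow> real) \<Rightarrow> ('m \<Rightarrow> 'e \<Rightarrow> 'e) \<Rightarrow> ('m \<Rightarrow> 'e \<Rightarrow> 'e \<Rightarrow> real) \<Rightarrow> bool" where
  "almost_kaehler A g J w \<longleftrightarrow> almost_hermitian A g J w \<and>
     (\<forall>X\<in>vector_fields A. \<forall>Y\<in>vector_fields A. \<forall>Z\<in>vector_fields A. \<forall>p.
        ext_deriv2 A w X Y Z p = 0)"

definition nijenhuis ::
  "('m, 'e::euclidean_space) chart set \<Rightarrow> ('m \<Rightarrow> 'e \<Rightarrow> 'e) \<Rightarrow>
   ('m \<Rightarrow> 'e) \<Rightarrow> ('m \<Rightarrow> 'e) \<Rightarrow> 'm \<Rightarrow> 'e" where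
  "nijenhuis A J X Y = (\<lambda>p.
       lie_bracket A (endo_app J X) (endo_app J Y) p
     - J p (lie_bracket A (endo_app J X) Y p)
     - J p (lie_bracket A X (endo_app J Y) p)
     - lie_bracket A X Y p)"

definition integrable_structure ::
  "('m, 'e::euclidean_space) chart set \<Rightarrow> ('m \<Rightarrow> 'e \<Rightarrow> 'e) \<Rightarrow> bool" where
  "integrable_structure A J \<longleftrightarrow>
     (\<forall>X\<in>vector_fields A. \<forall>Y\<in>vector_fields A. \<forall>p. nijenhuis A J X Y p = 0)"

definition kaehler ::
  "('m::{t2_space, second_countable_topology}, 'e::euclidean_space) chart set \<Rightarrow>
   ('m \<Rightarrow> 'e \<Rightarrow> 'e \<Rightarrow> real) \<Rightarrow> ('m \<Rightarrow> 'e \<Rightarrow> 'e) \<Rightarrow> ('m \<Rightarrow> 'e \<Rightarrow> 'e \<Rightarrow> real) \<Rightarrow> bool" where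
  "kaehler A g J w \<longleftrightarrow> almost_kaehler A g J w \<and> integrable_structure A J"

section \<open>The canonical connection and its curvature\<close>

text \<open>A connection is an operator on smooth vector fields; its values on other arguments are
  irrelevant.\<close>

definition linear_connection ::
  "('m, 'e::euclidean_space) chart set \<Rightarrow> (('m \<Rightarrow> 'e) \<Rightarrow> ('m \<Rightarrow> 'e) \<Rightarrow> 'm \<Rightarrow> 'e) \<Rightarrow> bool" where
  "linear_connection A D \<longleftrightarrow>
     (\<forall>X\<in>vector_fields A. \<forall>Y\<in>vector_fields A.
        D X Y \<in> vector_fields A \<and>
        (\<forall>Z\<in>vector_fields A.
           D (\<lambda>p. X p + Z p) Y = (\<lambda>p. D X Y p + D Z Y p) \<and>
           D X (\<lambda>p. Y p + Z p) = (\<lambda>p. D X Y p + D X Z p)) \<and>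
        (\<forall>f\<in>smooth_functions A.
           D (\<lambda>p. f p *\<^sub>R X p) Y = (\<lambda>p. f p *\<^sub>R D X Y p) \<and>
           D X (\<lambda>p. f p *\<^sub>R Y p) = (\<lambda>p. vf_deriv A X f p *\<^sub>R Y p + f p *\<^sub>R D X Y p)))"

definition covariant_deriv_metric ::
  "('m, 'e::euclidean_space) chart set \<Rightarrow> (('m \<Rightarrow> 'e) \<Rightarrow> ('m \<Rightarrow> 'e) \<Rightarrow> 'm \<Rightarrow> 'e) \<Rightarrow>
   ('m \<Rightarrow> 'e \<Rightarrow> 'e \<Rightarrow> real) \<Rightarrow> ('m \<Rightarrow> 'e) \<Rightarrow> ('m \<Rightarrow> 'e) \<Rightarrow> ('m \<Rightarrow> 'e) \<Rightarrow> 'm \<Rightarrow> real" where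
  "covariant_deriv_metric A D g X Y Z = (\<lambda>p.
     vf_deriv A X (\<lambda>q. g q (Y q) (Z q)) p - g p (D X Y p) (Z p) - g p (Y p) (D X Z p))"

definition covariant_deriv_endo ::
  "(('m \<Rightarrow> 'e::euclidean_space) \<Rightarrow> ('m \<Rightarrow> 'e) \<Rightarrow> 'm \<Rightarrow> 'e) \<Rightarrow> ('m \<Rightarrow> 'e \<Rightarrow> 'e) \<Rightarrow>
   ('m \<Rightarrow> 'e) \<Rightarrow> ('m \<Rightarrow> 'e) \<Rightarrow> 'm \<Rightarrow> 'e" where
  "covariant_deriv_endo D J X Y = (\<lambda>p. D X (endo_app J Y) p - J p (D X Y p))"

definition torsion ::
  "('m, 'e::euclidean_space) chart set \<Rightarrow> (('m \<Rightarrow> 'e) \<Rightarrow> ('m \<Rightarrow> 'e) \<Rightarrow> 'm \<Rightarrow> 'e) \<Rightarrow>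
   ('m \<Rightarrow> 'e) \<Rightarrow> ('m \<Rightarrow> 'e) \<Rightarrow> 'm \<Rightarrow> 'e" where
  "torsion A D X Y = (\<lambda>p. D X Y p - D Y X p - lie_bracket A X Y p)"

text \<open>The \<open>(1,1)\<close>-part of a \<open>TM\<close>-valued 2-form \<open>\<tau>\<close> is its \<open>J\<close>-invariant part
  \<open>(\<tau>(X, Y) + \<tau>(JX, JY)) / 2\<close>. After complexification this keeps \<open>\<tau>\<close> on pairs of one vector of
  type \<open>(1,0)\<close> and one of type \<open>(0,1)\<close> and kills it on pairs of vectors of equal type.\<close>

definition part_1_1 ::
  "('m \<Rightarrow> 'e \<Rightarrow> 'e) \<Rightarrow> (('m \<Rightarrow> 'e) \<Rightarrow> ('m \<Rightarrow> 'e) \<Rightarrow> 'm \<Rightarrow> 'e::euclidean_space) \<Rightarrow>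
   ('m \<Rightarrow> 'e) \<Rightarrow> ('m \<Rightarrow> 'e) \<Rightarrow> 'm \<Rightarrow> 'e" where
  "part_1_1 J \<tau> X Y = (\<lambda>p. (1 / 2) *\<^sub>R (\<tau> X Y p + \<tau> (endo_app J X) (endo_app J Y) p))"

definition canonical_connection ::
  "('m, 'e::euclidean_space) chart set \<Rightarrow> ('m \<Rightarrow> 'e \<Rightarrow> 'e \<Rightarrow> real) \<Rightarrow> ('m \<Rightarrow> 'e \<Rightarrow> 'e) \<Rightarrow>
   (('m \<Rightarrow> 'e) \<Rightarrow> ('m \<Rightarrow> 'e) \<Rightarrow> 'm \<Rightarrow> 'e) \<Rightarrow> bool" where
  "canonical_connection A g J D \<longleftrightarrow> linear_connection A D \<and>
     (\<forall>X\<in>vector_fields A. \<forall>Y\<in>vector_fields A. \<forall>Z\<in>vector_fields A. \<forall>p.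
        covariant_deriv_metric A D g X Y Z p = 0) \<and>
     (\<forall>X\<in>vector_fields A. \<forall>Y\<in>vector_fields A. \<forall>p. covariant_deriv_endo D J X Y p = 0) \<and>
     (\<forall>X\<in>vector_fields A. \<forall>Y\<in>vector_fields A. \<forall>p. part_1_1 J (torsion A D) X Y p = 0)"

definition curvature_tensor ::
  "('m, 'e::euclidean_space) chart set \<Rightarrow> ('m \<Rightarrow> 'e \<Rightarrow> 'e \<Rightarrow> real) \<Rightarrow>
   (('m \<Rightarrow> 'e) \<Rightarrow> ('m \<Rightarrow> 'e) \<Rightarrow> 'm \<Rightarrow> 'e) \<Rightarrow>
   ('m \<Rightarrow> 'e) \<Rightarrow> ('m \<Rightarrow> 'e) \<Rightarrow> ('m \<Rightarrow> 'e) \<Rightarrow> ('m \<Rightarrow> 'e) \<Rightarrow> 'm \<Rightarrow> real" where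
  "curvature_tensor A g D X Y Z W = (\<lambda>p.
     g p (D X (D Y Z) p - D Y (D X Z) p - D (lie_bracket A X Y) Z p) (W p))"

definition first_bianchi ::
  "('m, 'e::euclidean_space) chart set \<Rightarrow> ('m \<Rightarrow> 'e \<Rightarrow> 'e \<Rightarrow> real) \<Rightarrow>
   (('m \<Rightarrow> 'e) \<Rightarrow> ('m \<Rightarrow> 'e) \<Rightarrow> 'm \<Rightarrow> 'e) \<Rightarrow> bool" where
  "first_bianchi A g D \<longleftrightarrow>
     (\<forall>X\<in>vector_fields A. \<forall>Y\<in>vector_fields A. \<forall>Z\<in>vector_fields A. \<forall>W\<in>vector_fields A. \<forall>p.
        curvature_tensor A g D X Y Z W p + curvature_tensor A g D Y Z X W p
        + curvature_tensor A g D Z X Y W p = 0)"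

end

theory Submission
  imports Defs
begin

text \<open>Let \<open>T\<close> be the torsion of the canonical connection. Vanishing of its \<open>(1,1)\<close>-part together with
  \<open>d\<omega> = 0\<close> makes \<open>T\<close> complex antilinear in both arguments and forces \<open>g(T(X, Y), Z)\<close> to have vanishing
  cyclic sum; moreover \<open>N = 4 T\<close>. The general first Bianchi identity says that the cyclic sum of the
  curvature is the cyclic sum of \<open>(\<nabla>\<^sub>X T)(Y, Z) + T(T(X, Y), Z)\<close>. By assumption it is zero, and
  comparing complex types in \<open>X\<close>, \<open>Y\<close>, \<open>Z\<close> isolates \<open>T(T(X, Y), Z) = 0\<close>. The cyclic identity for
  \<open>T(X, Y), X, Y\<close> then gives \<open>g(T(X, Y), T(X, Y)) = 0\<close>.\<close>

section \<open>Smooth maps\<close>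

lemma frechet_derivative_eqI:
  "(f has_derivative f') (at x) \<Longrightarrow> frechet_derivative f (at x) = f'"
  using frechet_derivative_at by metis

lemma frechet_derivative_works':
  "f differentiable (at x) \<Longrightarrow> (f has_derivative frechet_derivative f (at x)) (at x)"
  using frechet_derivative_works by blast

lemma differentiable_transform_open:
  assumes "f differentiable (at x)" "open S" "x \<in> S" "\<And>y. y \<in> S \<Longrightarrow> f y = g y"
  shows "g differentiable (at x)"
proof -
  have "(g has_derivative frechet_derivative f (at x)) (at x)"
    by (rule has_derivative_transform_within_open[OF frechet_derivative_works'[OF assms(1)] assms(2-4)])
  then show ?thesis by (rule differentiableI)
qed

lemma frechet_derivative_cong_open:
  assumes "open S" "x \<in> S" "\<And>y. y \<in> S \<Longrightarrow> f y = g y"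
  shows "frechet_derivative f (at x) = frechet_derivative g (at x)"
proof -
  have "(f has_derivative f') (at x) \<longleftrightarrow> (g has_derivative f') (at x)" for f'
    using assms has_derivative_transform_within_open[of f f' x UNIV S g]
      has_derivative_transform_within_open[of g f' x UNIV S f] by auto
  then show ?thesis unfolding frechet_derivative_def by simp
qed

text \<open>Openness of \<open>S\<close> makes the derivative at a point of \<open>S\<close> depend
  only on values in \<open>S\<close>. Derivative formulas that hold only on \<open>S\<close> can
  then replace \<open>frechet_derivative\<close> inside the recursion.\<close>

lemma times_differentiable_on_cong:
  assumes "open S" "\<And>x. x \<in> S \<Longrightarrow> f x = g x" "times_differentiable_on n S f"
  shows "times_differentiable_on n S g"
  using assms
proof (induction n arbitrary: f g)
  case 0
  then show ?case by (metis continuous_on_cong times_differentiable_on.simps(1))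
next
  case (Suc n)
  have "frechet_derivative f (at x) v = frechet_derivative g (at x) v" if "x \<in> S" for x v
    using frechet_derivative_cong_open[OF Suc.prems(1) that, of f g] Suc.prems(2) by simp
  then have "times_differentiable_on n S (\<lambda>x. frechet_derivative g (at x) v)" for v
    using Suc.IH[OF Suc.prems(1), of "\<lambda>x. frechet_derivative f (at x) v"] Suc.prems(3) by simp
  moreover have "g differentiable (at x)" if "x \<in> S" for x
    using differentiable_transform_open[OF _ Suc.prems(1) that, of f g] Suc.prems(2,3) that by simp
  ultimately show ?case by simp
qed

lemma times_differentiable_on_Suc_imp:
  "times_differentiable_on (Suc n) S f \<Longrightarrow> times_differentiable_on n S f"
proof (induction n arbitrary: f)
  case 0
  then show ?case
    by (auto intro!: continuous_at_imp_continuous_on differentiable_imp_continuous_within)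
next
  case (Suc n)
  then show ?case by (metis times_differentiable_on.simps(2))
qed

lemma times_differentiable_on_const: "times_differentiable_on n S (\<lambda>x. c)"
  by (induction n arbitrary: c) (simp_all add: frechet_derivative_const)

lemma times_differentiable_on_add:
  assumes "open S" "times_differentiable_on n S f" "times_differentiable_on n S g"
  shows "times_differentiable_on n S (\<lambda>x. f x + g x)"
  using assms
proof (induction n arbitrary: f g)
  case 0
  then show ?case by (simp add: continuous_on_add)
next
  case (Suc n)
  have "times_differentiable_on n S (\<lambda>x. frechet_derivative (\<lambda>x. f x + g x) (at x) v)" for v
  proof (rule times_differentiable_on_cong[OF Suc.prems(1)])
    show "times_differentiable_on n S (\<lambda>x. frechet_derivative f (at x) v + frechet_derivative g (at x) v)"
      using Suc by simp
    fix x assume "x \<in> S"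
    then show "frechet_derivative f (at x) v + frechet_derivative g (at x) v
        = frechet_derivative (\<lambda>x. f x + g x) (at x) v"
      using frechet_derivative_eqI[OF has_derivative_add[of f _ "at x" g]] Suc.prems
      by (metis (no_types, lifting) frechet_derivative_works times_differentiable_on.simps(2))
  qed
  then show ?case using Suc.prems by simp
qed

text \<open>By the product rule a directional derivative is a sum of two products, to which the
  induction hypothesis applies; each contains an undifferentiated factor, whose order is lowered by
  \<open>times_differentiable_on_Suc_imp\<close>. One proof serves both \<open>scaleR\<close> and
  the inner product.\<close>

lemma times_differentiable_on_bilinear:
  fixes f :: "'x::euclidean_space \<Rightarrow> 'b::euclidean_space" and g :: "'x \<Rightarrow> 'c::euclidean_space"
    and prod :: "'b \<Rightarrow> 'c \<Rightarrow> 'd::euclidean_space"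
  assumes "bounded_bilinear prod"
    and "open S" "times_differentiable_on n S f" "times_differentiable_on n S g"
  shows "times_differentiable_on n S (\<lambda>x. prod (f x) (g x))"
  using assms(2-)
proof (induction n arbitrary: f g)
  case 0
  then show ?case using bounded_bilinear.continuous_on[OF assms(1)] by simp
next
  case (Suc n)
  have d: "((\<lambda>x. prod (f x) (g x)) has_derivative
     (\<lambda>v. prod (f x) (frechet_derivative g (at x) v) + prod (frechet_derivative f (at x) v) (g x))) (at x)"
    if "x \<in> S" for x
    by (rule bounded_bilinear.FDERIV[OF assms(1)])
      (use Suc.prems that in \<open>auto simp: frechet_derivative_works[symmetric]\<close>)
  have "times_differentiable_on n S (\<lambda>x. frechet_derivative (\<lambda>x. prod (f x) (g x)) (at x) v)" for v
  proof (rule times_differentiable_on_cong[OF Suc.prems(1)])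
    show "times_differentiable_on n S
       (\<lambda>x. prod (f x) (frechet_derivative g (at x) v) + prod (frechet_derivative f (at x) v) (g x))"
      using Suc.prems Suc.prems(2,3)[THEN times_differentiable_on_Suc_imp]
      by (intro times_differentiable_on_add Suc.IH) auto
    fix x assume "x \<in> S"
    then show "prod (f x) (frechet_derivative g (at x) v) + prod (frechet_derivative f (at x) v) (g x)
        = frechet_derivative (\<lambda>x. prod (f x) (g x)) (at x) v"
      using frechet_derivative_eqI[OF d] by simp
  qed
  then show ?case using d by (auto simp: differentiable_def)
qed

lemma smooth_on_cong:
  "open S \<Longrightarrow> (\<And>x. x \<in> S \<Longrightarrow> f x = g x) \<Longrightarrow> smooth_on S f \<Longrightarrow> smooth_on S g"
  unfolding smooth_on_def using times_differentiable_on_cong by blast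

lemma smooth_on_const: "smooth_on S (\<lambda>x. c)"
  unfolding smooth_on_def using times_differentiable_on_const by blast

lemma smooth_on_add:
  "open S \<Longrightarrow> smooth_on S f \<Longrightarrow> smooth_on S g \<Longrightarrow> smooth_on S (\<lambda>x. f x + g x)"
  unfolding smooth_on_def using times_differentiable_on_add by blast

lemma smooth_on_bilinear:
  fixes f :: "'x::euclidean_space \<Rightarrow> 'b::euclidean_space" and g :: "'x \<Rightarrow> 'c::euclidean_space"
    and prod :: "'b \<Rightarrow> 'c \<Rightarrow> 'd::euclidean_space"
  assumes "bounded_bilinear prod"
    and "open S" "smooth_on S f" "smooth_on S g"
  shows "smooth_on S (\<lambda>x. prod (f x) (g x))"
  using assms times_differentiable_on_bilinear[OF assms(1)] unfolding smooth_on_def by blast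

lemmas smooth_on_scaleR = smooth_on_bilinear[OF bounded_bilinear_scaleR]
lemmas smooth_on_inner = smooth_on_bilinear[OF bounded_bilinear_inner]

lemma smooth_on_sum:
  "open S \<Longrightarrow> (\<And>i. i \<in> I \<Longrightarrow> smooth_on S (f i)) \<Longrightarrow> smooth_on S (\<lambda>x. \<Sum>i\<in>I. f i x)"
  by (induction I rule: infinite_finite_induct) (auto simp: smooth_on_const smooth_on_add)

lemma smooth_on_diff:
  fixes f :: "'x::euclidean_space \<Rightarrow> 'b::euclidean_space"
  assumes "open S" "smooth_on S f" "smooth_on S g"
  shows "smooth_on S (\<lambda>x. f x - g x)"
proof -
  have "smooth_on S (\<lambda>x. f x + (-1) *\<^sub>R g x)"
    by (intro smooth_on_add smooth_on_scaleR smooth_on_const assms)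
  then show ?thesis by simp
qed

lemma smooth_on_directional:
  "smooth_on S f \<Longrightarrow> smooth_on S (\<lambda>x. frechet_derivative f (at x) v)"
  unfolding smooth_on_def by (metis times_differentiable_on.simps(2))

lemma smooth_on_differentiable:
  "smooth_on S f \<Longrightarrow> x \<in> S \<Longrightarrow> f differentiable (at x)"
  unfolding smooth_on_def by (metis times_differentiable_on.simps(2))

lemma smooth_on_continuous: "smooth_on S f \<Longrightarrow> continuous_on S f"
  unfolding smooth_on_def by (metis times_differentiable_on.simps(1))

lemma smooth_on_has_derivative:
  "smooth_on S f \<Longrightarrow> x \<in> S \<Longrightarrow> (f has_derivative frechet_derivative f (at x)) (at x)"
  using smooth_on_differentiable frechet_derivative_works by blast

lemma smooth_on_linear_derivative:
  "smooth_on S f \<Longrightarrow> x \<in> S \<Longrightarrow> linear (frechet_derivative f (at x))"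
  using smooth_on_differentiable linear_frechet_derivative by blast

lemma smooth_on_subset: "smooth_on S f \<Longrightarrow> T \<subseteq> S \<Longrightarrow> smooth_on T f"
proof -
  have "times_differentiable_on n S f \<Longrightarrow> T \<subseteq> S \<Longrightarrow> times_differentiable_on n T f" for n
    by (induction n arbitrary: f) (auto intro: continuous_on_subset)
  then show "smooth_on S f \<Longrightarrow> T \<subseteq> S \<Longrightarrow> smooth_on T f"
    unfolding smooth_on_def by blast
qed

text \<open>Smoothness is defined through derivatives in fixed directions. This expansion replaces a
  direction that varies with the point by finitely many fixed ones with varying
  coefficients.\<close>

lemma linear_eq_sum_Basis:
  fixes u :: "'a::euclidean_space"
  assumes "linear L"
  shows "L u = (\<Sum>b\<in>Basis. (u \<bullet> b) *\<^sub>R L b)"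
proof -
  have "L u = L (\<Sum>b\<in>Basis. (u \<bullet> b) *\<^sub>R b)" by (simp add: euclidean_representation)
  also have "\<dots> = (\<Sum>b\<in>Basis. (u \<bullet> b) *\<^sub>R L b)"
    using assms by (simp add: linear_sum linear_cmul)
  finally show ?thesis .
qed

lemma smooth_on_derivative_along:
  assumes "open S" "smooth_on S f" "smooth_on S X"
  shows "smooth_on S (\<lambda>x. frechet_derivative f (at x) (X x))"
proof (rule smooth_on_cong[OF assms(1)])
  show "smooth_on S (\<lambda>x. \<Sum>b\<in>Basis. (X x \<bullet> b) *\<^sub>R frechet_derivative f (at x) b)"
    by (intro smooth_on_sum smooth_on_scaleR smooth_on_inner smooth_on_const smooth_on_directional assms)
  show "(\<Sum>b\<in>Basis. (X x \<bullet> b) *\<^sub>R frechet_derivative f (at x) b) = frechet_derivative f (at x) (X x)"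
    if "x \<in> S" for x
    by (rule linear_eq_sum_Basis[OF smooth_on_linear_derivative[OF assms(2) that], symmetric])
qed

section \<open>Hessians of smooth maps\<close>

definition second_derivative ::
  "('a::euclidean_space \<Rightarrow> 'b::euclidean_space) \<Rightarrow> 'a \<Rightarrow> 'a \<Rightarrow> 'a \<Rightarrow> 'b" where
  "second_derivative f x u v = frechet_derivative (\<lambda>y. frechet_derivative f (at y) u) (at x) v"

text \<open>The direction \<open>u\<close> belongs to the inner derivative. That derivative is
  linear in \<open>u\<close> at every point of the open set \<open>S\<close>, so its expansion may
  be differentiated term by term.\<close>

lemma second_derivative_eq_sum:
  assumes "open S" "smooth_on S f" "x \<in> S"
  shows "second_derivative f x u v = (\<Sum>b\<in>Basis. (u \<bullet> b) *\<^sub>R second_derivative f x b v)"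
proof -
  have "((\<lambda>y. \<Sum>b\<in>Basis. (u \<bullet> b) *\<^sub>R frechet_derivative f (at y) b) has_derivative
     (\<lambda>v. \<Sum>b\<in>Basis. (u \<bullet> b) *\<^sub>R second_derivative f x b v)) (at x)"
    unfolding second_derivative_def
    by (intro has_derivative_sum has_derivative_scaleR_right
        smooth_on_has_derivative[OF smooth_on_directional, OF assms(2,3)])
  then have "((\<lambda>y. frechet_derivative f (at y) u) has_derivative
     (\<lambda>v. \<Sum>b\<in>Basis. (u \<bullet> b) *\<^sub>R second_derivative f x b v)) (at x)"
    by (rule has_derivative_transform_within_open[OF _ assms(1,3)])
      (rule linear_eq_sum_Basis[OF smooth_on_linear_derivative[OF assms(2)], symmetric])
  from frechet_derivative_eqI[OF this] show ?thesis
    unfolding second_derivative_def by metis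
qed

text \<open>Product rule after expanding \<open>X y\<close> in the standard basis: one term comes
  from moving the base point, the other from moving the direction.\<close>

lemma has_derivative_derivative_along:
  assumes "open S" "smooth_on S f" "x \<in> S" "(X has_derivative X') (at x)"
  shows "((\<lambda>y. frechet_derivative f (at y) (X y)) has_derivative
     (\<lambda>v. second_derivative f x (X x) v + frechet_derivative f (at x) (X' v))) (at x)"
proof -
  have "((\<lambda>y. \<Sum>b\<in>Basis. (X y \<bullet> b) *\<^sub>R frechet_derivative f (at y) b) has_derivative
     (\<lambda>v. \<Sum>b\<in>Basis. (X x \<bullet> b) *\<^sub>R second_derivative f x b v + (X' v \<bullet> b) *\<^sub>R frechet_derivative f (at x) b)) (at x)"
    unfolding second_derivative_def
    by (intro has_derivative_sum has_derivative_scaleR has_derivative_inner_left assms(4)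
        smooth_on_has_derivative[OF smooth_on_directional, OF assms(2,3)])
  then have "((\<lambda>y. frechet_derivative f (at y) (X y)) has_derivative
     (\<lambda>v. \<Sum>b\<in>Basis. (X x \<bullet> b) *\<^sub>R second_derivative f x b v + (X' v \<bullet> b) *\<^sub>R frechet_derivative f (at x) b)) (at x)"
    by (rule has_derivative_transform_within_open[OF _ assms(1,3)])
      (rule linear_eq_sum_Basis[OF smooth_on_linear_derivative[OF assms(2)], symmetric])
  moreover have "(\<Sum>b\<in>Basis. (X x \<bullet> b) *\<^sub>R second_derivative f x b v + (X' v \<bullet> b) *\<^sub>R frechet_derivative f (at x) b)
     = second_derivative f x (X x) v + frechet_derivative f (at x) (X' v)" for v
    by (simp only: sum.distrib second_derivative_eq_sum[OF assms(1-3), of "X x" v]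
        linear_eq_sum_Basis[OF smooth_on_linear_derivative[OF assms(2,3)], of "X' v"])
  ultimately show ?thesis by simp
qed


section \<open>Symmetry of second derivatives\<close>

lemma DERIV_along_line:
  fixes f :: "'a::real_normed_vector \<Rightarrow> real"
  assumes "f differentiable (at (x + s *\<^sub>R u))"
  shows "((\<lambda>s. f (x + s *\<^sub>R u)) has_real_derivative frechet_derivative f (at (x + s *\<^sub>R u)) u) (at s)"
proof -
  have "((\<lambda>s. x + s *\<^sub>R u) has_derivative (\<lambda>h. h *\<^sub>R u)) (at s)"
    by (auto intro!: derivative_eq_intros)
  then have "((\<lambda>s. f (x + s *\<^sub>R u)) has_derivative (\<lambda>h. frechet_derivative f (at (x + s *\<^sub>R u)) (h *\<^sub>R u))) (at s)"
    by (rule has_derivative_compose[where f = "\<lambda>s. x + s *\<^sub>R u", OF _ frechet_derivative_works'[OF assms]])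
  moreover have "frechet_derivative f (at (x + s *\<^sub>R u)) (h *\<^sub>R u) = frechet_derivative f (at (x + s *\<^sub>R u)) u * h" for h
    using linear_cmul[OF linear_frechet_derivative[OF assms]] by simp
  ultimately show ?thesis unfolding has_field_derivative_def by simp
qed

text \<open>The mean value theorem is applied twice: along \<open>u\<close> to \<open>G\<close>, the
  increment of \<open>f\<close> over the step \<open>s *\<^sub>R v\<close>, and then along
  \<open>v\<close> to \<open>H\<close>, the derivative of \<open>f\<close> in direction
  \<open>u\<close>.\<close>

lemma second_difference_mean_value:
  fixes f :: "'a::euclidean_space \<Rightarrow> real"
  assumes "\<And>y. y \<in> cball x r \<Longrightarrow> f differentiable (at y)"
    and "\<And>y. y \<in> cball x r \<Longrightarrow> (\<lambda>y. frechet_derivative f (at y) u) differentiable (at y)"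
    and "0 < s" "s * (norm u + norm v) \<le> r"
  obtains y where "y \<in> cball x (s * (norm u + norm v))"
    "f (x + s *\<^sub>R u + s *\<^sub>R v) - f (x + s *\<^sub>R u) - f (x + s *\<^sub>R v) + f x = s * s * second_derivative f y u v"
proof -
  \<comment> \<open>Every point of the parallelogram spanned by the two steps stays in the ball
    where the differentiability hypotheses hold.\<close>
  have mem: "x + a *\<^sub>R u + b *\<^sub>R v \<in> cball x (s * (norm u + norm v))"
    if "0 \<le> a" "a \<le> s" "0 \<le> b" "b \<le> s" for a b
  proof -
    have "norm (a *\<^sub>R u + b *\<^sub>R v) \<le> a * norm u + b * norm v"
      using norm_triangle_ineq[of "a *\<^sub>R u" "b *\<^sub>R v"] that by simp
    also have "\<dots> \<le> s * norm u + s * norm v"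
      using that by (intro add_mono mult_right_mono) auto
    finally show ?thesis by (simp add: dist_norm add.assoc algebra_simps norm_minus_commute)
  qed
  then have mem': "x + a *\<^sub>R u + b *\<^sub>R v \<in> cball x r"
    if "0 \<le> a" "a \<le> s" "0 \<le> b" "b \<le> s" for a b
    using assms(4) that by (meson mem_cball order_trans)
  define G where "G a = f ((x + s *\<^sub>R v) + a *\<^sub>R u) - f (x + a *\<^sub>R u)" for a
  define G' where "G' a = frechet_derivative f (at ((x + s *\<^sub>R v) + a *\<^sub>R u)) u
     - frechet_derivative f (at (x + a *\<^sub>R u)) u" for a
  have "(G has_real_derivative G' a) (at a)" if "0 \<le> a" "a \<le> s" for a
    unfolding G_def G'_def
    using mem'[of a s] mem'[of a 0] assms(3) that
    by (intro DERIV_diff DERIV_along_line assms(1)) (auto simp: add_ac)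
  then obtain a where a: "0 < a" "a < s" "G s - G 0 = (s - 0) * G' a"
    using MVT2[of 0 s G G'] assms(3) by auto
  define H where "H b = frechet_derivative f (at ((x + a *\<^sub>R u) + b *\<^sub>R v)) u" for b
  have "(H has_real_derivative second_derivative f (x + a *\<^sub>R u + b *\<^sub>R v) u v) (at b)"
    if "0 \<le> b" "b \<le> s" for b
    unfolding H_def second_derivative_def
    using mem'[of a b] a that by (intro DERIV_along_line assms(2)) auto
  then obtain b where b: "0 < b" "b < s"
      "H s - H 0 = (s - 0) * second_derivative f (x + a *\<^sub>R u + b *\<^sub>R v) u v"
    using MVT2[of 0 s H "\<lambda>b. second_derivative f (x + a *\<^sub>R u + b *\<^sub>R v) u v"] assms(3) by auto
  have "G' a = H s - H 0" by (simp add: G'_def H_def add_ac)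
  then have "G s - G 0 = s * s * second_derivative f (x + a *\<^sub>R u + b *\<^sub>R v) u v"
    using a b by simp
  moreover have "G s - G 0 = f (x + s *\<^sub>R u + s *\<^sub>R v) - f (x + s *\<^sub>R u) - f (x + s *\<^sub>R v) + f x"
    by (simp add: G_def add_ac)
  ultimately show ?thesis using that mem[of a b] a b by simp
qed

text \<open>The second difference over a parallelogram is symmetric in \<open>u\<close> and
  \<open>v\<close>. It is \<open>s * s\<close> times either mixed derivative, each taken at some
  point near \<open>x\<close>, and both mixed derivatives are continuous at
  \<open>x\<close>.\<close>

lemma second_derivative_commute_real:
  fixes f :: "'a::euclidean_space \<Rightarrow> real"
  assumes "open S" "smooth_on S f" "x \<in> S"
  shows "second_derivative f x u v = second_derivative f x v u"
proof (rule ccontr)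
  assume ne: "\<not> ?thesis"
  \<comment> \<open>Half the gap, since two errors smaller than \<open>e\<close> cannot bridge
    it.\<close>
  define e where "e = \<bar>second_derivative f x u v - second_derivative f x v u\<bar> / 2"
  have "e > 0" using ne by (simp add: e_def)
  have cont: "\<exists>d>0. \<forall>y. dist y x < d \<longrightarrow> \<bar>second_derivative f y p q - second_derivative f x p q\<bar> < e" for p q
  proof -
    have "smooth_on S (\<lambda>y. second_derivative f y p q)"
      unfolding second_derivative_def by (intro smooth_on_directional assms)
    then have "isCont (\<lambda>y. second_derivative f y p q) x"
      using smooth_on_continuous continuous_on_eq_continuous_at assms(1,3) by blast
    then show ?thesis
      using \<open>e > 0\<close> unfolding continuous_at_eps_delta dist_real_def by blast
  qed
  obtain d1 where d1: "d1 > 0" "\<And>y. dist y x < d1 \<Longrightarrow> \<bar>second_derivative f y u v - second_derivative f x u v\<bar> < e"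
    using cont by blast
  obtain d2 where d2: "d2 > 0" "\<And>y. dist y x < d2 \<Longrightarrow> \<bar>second_derivative f y v u - second_derivative f x v u\<bar> < e"
    using cont by blast
  obtain r where r: "r > 0" "cball x r \<subseteq> S"
    using assms(1,3) open_contains_cball by blast
  define m where "m = min r (min d1 d2) / 2"
  \<comment> \<open>The summand 1 keeps the denominator positive even if \<open>u\<close> and
    \<open>v\<close> are both zero.\<close>
  define s where "s = m / (norm u + norm v + 1)"
  have m: "m > 0" "m < d1" "m < d2" "m \<le> r" using d1 d2 r by (auto simp: m_def)
  have s: "s > 0" using m by (simp add: s_def add_nonneg_pos)
  have sm: "s * (norm u + norm v) \<le> m"
  proof -
    have "s * (norm u + norm v + 1) = m"
      using add_nonneg_pos[of "norm u + norm v" 1] by (simp add: s_def)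
    then show ?thesis using s by (simp add: distrib_left)
  qed
  have diff: "f differentiable (at y)" "(\<lambda>y. frechet_derivative f (at y) p) differentiable (at y)"
    if "y \<in> cball x r" for y p
    using that r assms smooth_on_differentiable smooth_on_directional by blast+
  obtain y where y: "y \<in> cball x (s * (norm u + norm v))"
      "f (x + s *\<^sub>R u + s *\<^sub>R v) - f (x + s *\<^sub>R u) - f (x + s *\<^sub>R v) + f x = s * s * second_derivative f y u v"
    using second_difference_mean_value[OF diff s, of x r u v] sm m by auto
  obtain z where z: "z \<in> cball x (s * (norm v + norm u))"
      "f (x + s *\<^sub>R v + s *\<^sub>R u) - f (x + s *\<^sub>R v) - f (x + s *\<^sub>R u) + f x = s * s * second_derivative f z v u"
    using second_difference_mean_value[OF diff s, of x r v u] sm m by (auto simp: add.commute)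
  have swap: "x + s *\<^sub>R v + s *\<^sub>R u = x + s *\<^sub>R u + s *\<^sub>R v" by simp
  have "s * s * second_derivative f y u v = s * s * second_derivative f z v u"
    using y(2) z(2)[unfolded swap] by linarith
  then have mixed: "second_derivative f y u v = second_derivative f z v u" using s by simp
  have "dist y x < d1" "dist z x < d2"
    using y(1) z(1) sm m by (auto simp: dist_commute add.commute)
  from d1(2)[OF this(1)] d2(2)[OF this(2)] show False
    using abs_triangle_ineq4[of "second_derivative f y u v - second_derivative f x v u"
        "second_derivative f y u v - second_derivative f x u v"] mixed
    unfolding e_def by simp
qed

text \<open>Taking the component along a basis vector commutes with both differentiations, which
  reduces the claim to real-valued maps.\<close>

lemma second_derivative_commute:
  assumes "open S" "smooth_on S f" "x \<in> S"
  shows "second_derivative f x u v = second_derivative f x v u"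
proof (rule euclidean_eqI)
  fix b :: 'b assume "b \<in> Basis"
  have d: "frechet_derivative (\<lambda>y. h y \<bullet> b) (at y) = (\<lambda>u. frechet_derivative h (at y) u \<bullet> b)"
    if "smooth_on S h" "y \<in> S" for h y
    by (intro frechet_derivative_eqI has_derivative_inner_left smooth_on_has_derivative[OF that])
  have "second_derivative (\<lambda>y. f y \<bullet> b) x u v = second_derivative f x u v \<bullet> b" for u v
  proof -
    have "frechet_derivative (\<lambda>y. frechet_derivative (\<lambda>y. f y \<bullet> b) (at y) u) (at x)
        = frechet_derivative (\<lambda>y. frechet_derivative f (at y) u \<bullet> b) (at x)"
      by (rule frechet_derivative_cong_open[OF assms(1,3)]) (simp add: d[OF assms(2)])
    also have "\<dots> = (\<lambda>v. second_derivative f x u v \<bullet> b)"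
      unfolding second_derivative_def by (rule d[OF smooth_on_directional[OF assms(2)] assms(3)])
    finally show ?thesis by (simp add: second_derivative_def)
  qed
  moreover have "smooth_on S (\<lambda>y. f y \<bullet> b)" by (intro smooth_on_inner assms smooth_on_const)
  ultimately show "second_derivative f x u v \<bullet> b = second_derivative f x v u \<bullet> b"
    using second_derivative_commute_real assms(1,3) by metis
qed

section \<open>The Lie bracket\<close>

text \<open>Euclidean counterpart of \<open>lie_bracket\<close> with the same sign. Identities are
  proved here and carried to the manifold through \<open>local_rep\<close>.\<close>

definition bracket :: "('a::euclidean_space \<Rightarrow> 'a) \<Rightarrow> ('a \<Rightarrow> 'a) \<Rightarrow> 'a \<Rightarrow> 'a" where
  "bracket X Y x = frechet_derivative Y (at x) (X x) - frechet_derivative X (at x) (Y x)"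

lemma smooth_on_bracket:
  "open S \<Longrightarrow> smooth_on S X \<Longrightarrow> smooth_on S Y \<Longrightarrow> smooth_on S (bracket X Y)"
  unfolding bracket_def by (intro smooth_on_diff smooth_on_derivative_along)

lemma bracket_cong:
  assumes "open S" "x \<in> S" "\<And>y. y \<in> S \<Longrightarrow> X y = X' y" "\<And>y. y \<in> S \<Longrightarrow> Y y = Y' y"
  shows "bracket X Y x = bracket X' Y' x"
  using frechet_derivative_cong_open[OF assms(1,2,3)] frechet_derivative_cong_open[OF assms(1,2,4)] assms
  unfolding bracket_def by simp

lemma bracket_add_right:
  assumes "smooth_on S X" "smooth_on S Y" "smooth_on S Z" "x \<in> S"
  shows "bracket X (\<lambda>x. Y x + Z x) x = bracket X Y x + bracket X Z x"
proof -
  have "frechet_derivative (\<lambda>x. Y x + Z x) (at x) = (\<lambda>v. frechet_derivative Y (at x) v + frechet_derivative Z (at x) v)"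
    using assms by (intro frechet_derivative_eqI has_derivative_add smooth_on_has_derivative)
  then show ?thesis
    using linear_add[OF smooth_on_linear_derivative[OF assms(1,4)]] unfolding bracket_def by simp
qed

lemma bracket_has_derivative:
  assumes "open S" "smooth_on S X" "smooth_on S Y" "x \<in> S"
  shows "(bracket X Y has_derivative (\<lambda>v.
     second_derivative Y x (X x) v + frechet_derivative Y (at x) (frechet_derivative X (at x) v)
     - (second_derivative X x (Y x) v + frechet_derivative X (at x) (frechet_derivative Y (at x) v)))) (at x)"
  unfolding bracket_def
  by (intro has_derivative_diff has_derivative_derivative_along[OF assms(1)] assms
      smooth_on_has_derivative[OF assms(2,4)] smooth_on_has_derivative[OF assms(3,4)])

text \<open>In the expansion the Hessian terms cancel in pairs by symmetry of second derivatives,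
  and every composition of two first derivatives occurs twice with opposite signs.\<close>

lemma bracket_jacobi:
  assumes "open S" "smooth_on S X" "smooth_on S Y" "smooth_on S Z" "x \<in> S"
  shows "bracket X (bracket Y Z) x + bracket Y (bracket Z X) x + bracket Z (bracket X Y) x = 0"
proof -
  have lin: "frechet_derivative F (at x) (a - b) = frechet_derivative F (at x) a - frechet_derivative F (at x) b"
    if "smooth_on S F" for F :: "'a \<Rightarrow> 'a" and a b
    using linear_diff[OF smooth_on_linear_derivative[OF that assms(5)]] .
  note d = frechet_derivative_eqI[OF bracket_has_derivative[OF assms(1) _ _ assms(5)]]
  show ?thesis
    unfolding bracket_def[of X "bracket Y Z"] bracket_def[of Y "bracket Z X"] bracket_def[of Z "bracket X Y"]
      d[OF assms(2,3)] d[OF assms(3,4)] d[OF assms(4,2)]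
    unfolding bracket_def lin[OF assms(2)] lin[OF assms(3)] lin[OF assms(4)]
    using second_derivative_commute[OF assms(1,2,5), of "Y x" "Z x"]
      second_derivative_commute[OF assms(1,3,5), of "Z x" "X x"]
      second_derivative_commute[OF assms(1,4,5), of "X x" "Y x"]
    by (simp add: algebra_simps)
qed

text \<open>Differentiating \<open>Y' \<circ> \<phi> = D\<phi> Y\<close> along \<open>X\<close> produces the Hessian term \<open>D\<^sup>2\<phi>(Y, X)\<close>, which is symmetric and
  hence cancels.\<close>

lemma bracket_pushforward:
  assumes "open S" "smooth_on S \<phi>" "x \<in> S"
    and "smooth_on S X" "smooth_on S Y"
    and X': "X' differentiable (at (\<phi> x))" "\<And>y. y \<in> S \<Longrightarrow> X' (\<phi> y) = frechet_derivative \<phi> (at y) (X y)"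
    and Y': "Y' differentiable (at (\<phi> x))" "\<And>y. y \<in> S \<Longrightarrow> Y' (\<phi> y) = frechet_derivative \<phi> (at y) (Y y)"
  shows "bracket X' Y' (\<phi> x) = frechet_derivative \<phi> (at x) (bracket X Y x)"
proof -
  have *: "frechet_derivative Y' (at (\<phi> x)) (frechet_derivative \<phi> (at x) v)
      = second_derivative \<phi> x (Y x) v + frechet_derivative \<phi> (at x) (frechet_derivative Y (at x) v)"
    if Y: "smooth_on S Y" "Y' differentiable (at (\<phi> x))"
      "\<And>y. y \<in> S \<Longrightarrow> Y' (\<phi> y) = frechet_derivative \<phi> (at y) (Y y)" for Y Y' v
  proof -
    have "((\<lambda>y. Y' (\<phi> y)) has_derivative (\<lambda>v. frechet_derivative Y' (at (\<phi> x)) (frechet_derivative \<phi> (at x) v))) (at x)"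
      by (rule has_derivative_compose[OF smooth_on_has_derivative[OF assms(2,3)] frechet_derivative_works'[OF Y(2)]])
    then have "((\<lambda>y. frechet_derivative \<phi> (at y) (Y y)) has_derivative
        (\<lambda>v. frechet_derivative Y' (at (\<phi> x)) (frechet_derivative \<phi> (at x) v))) (at x)"
      by (rule has_derivative_transform_within_open[OF _ assms(1,3)]) (rule Y(3))
    then show ?thesis
      using fun_cong[OF has_derivative_unique[OF _
          has_derivative_derivative_along[OF assms(1-3) smooth_on_has_derivative[OF Y(1) assms(3)]]]]
      by blast
  qed
  show ?thesis
    using second_derivative_commute[OF assms(1-3), of "X x" "Y x"]
    by (simp add: bracket_def X'(2)[OF assms(3)] Y'(2)[OF assms(3)] *[OF assms(4) X'] *[OF assms(5) Y']
      linear_diff[OF smooth_on_linear_derivative[OF assms(2,3)]])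
qed

section \<open>Vector fields in charts\<close>

definition transition :: "('m, 'e) chart \<Rightarrow> ('m, 'e) chart \<Rightarrow> 'e \<Rightarrow> 'e" where
  "transition c d = snd d \<circ> chart_inv c"

definition overlap :: "('m, 'e) chart \<Rightarrow> ('m, 'e) chart \<Rightarrow> 'e set" where
  "overlap c d = snd c ` (fst c \<inter> fst d)"

locale smooth_atlas =
  fixes A :: "('m::{t2_space, second_countable_topology}, 'e::euclidean_space) chart set"
  assumes smooth_manifold: "smooth_manifold A"
begin

lemma chart_homeomorphism:
  assumes "c \<in> A"
  shows chart_inv_left: "p \<in> fst c \<Longrightarrow> chart_inv c (snd c p) = p"
    and chart_inv_right: "x \<in> chart_image c \<Longrightarrow> snd c (chart_inv c x) = x"
    and chart_inv_mem: "x \<in> chart_image c \<Longrightarrow> chart_inv c x \<in> fst c"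
    and chart_mem: "p \<in> fst c \<Longrightarrow> snd c p \<in> chart_image c"
    and open_chart_dom: "open (fst c)"
    and open_chart_image: "open (chart_image c)"
    and continuous_chart_inv: "continuous_on (chart_image c) (chart_inv c)"
proof -
  have c: "is_chart c" using smooth_manifold assms unfolding smooth_manifold_def by blast
  then have h: "homeomorphism (fst c) (chart_image c) (snd c) (chart_inv c)"
    by (simp add: is_chart_def)
  show "p \<in> fst c \<Longrightarrow> chart_inv c (snd c p) = p" "x \<in> chart_image c \<Longrightarrow> snd c (chart_inv c x) = x"
    using h by (simp_all add: homeomorphism_def)
  show "x \<in> chart_image c \<Longrightarrow> chart_inv c x \<in> fst c" "p \<in> fst c \<Longrightarrow> snd c p \<in> chart_image c"
    using homeomorphism_image1[OF h] homeomorphism_image2[OF h] by blast+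
  show "open (fst c)" "open (chart_image c)" using c by (simp_all add: is_chart_def)
  show "continuous_on (chart_image c) (chart_inv c)" using homeomorphism_cont2[OF h] .
qed

lemma chart_at_mem: "chart_at A p \<in> A" and mem_chart_at: "p \<in> fst (chart_at A p)"
proof -
  have "\<exists>c. c \<in> A \<and> p \<in> fst c"
    using smooth_manifold unfolding smooth_manifold_def by blast
  from someI_ex[OF this] show "chart_at A p \<in> A" "p \<in> fst (chart_at A p)"
    unfolding chart_at_def by auto
qed

lemma open_image_chart:
  assumes "c \<in> A" "open U" "U \<subseteq> fst c"
  shows "open (snd c ` U)"
proof -
  \<comment> \<open>The image is rewritten as a preimage under the continuous inverse chart.\<close>
  have "snd c ` U = chart_image c \<inter> chart_inv c -` U"
    using assms chart_inv_left[OF assms(1)] chart_inv_right[OF assms(1)] chart_mem[OF assms(1)]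
    by (force simp: image_iff)
  then show ?thesis
    using continuous_open_preimage[OF continuous_chart_inv[OF assms(1)] open_chart_image[OF assms(1)] assms(2)]
    by simp
qed

lemma open_overlap: "c \<in> A \<Longrightarrow> d \<in> A \<Longrightarrow> open (overlap c d)"
  unfolding overlap_def by (intro open_image_chart open_Int open_chart_dom) auto

lemma smooth_on_transition: "c \<in> A \<Longrightarrow> d \<in> A \<Longrightarrow> smooth_on (overlap c d) (transition c d)"
  using smooth_manifold unfolding smooth_manifold_def overlap_def transition_def by blast

lemma mem_overlap: "p \<in> fst c \<Longrightarrow> p \<in> fst d \<Longrightarrow> snd c p \<in> overlap c d"
  unfolding overlap_def by blast

lemma overlap_subset: "overlap c d \<subseteq> chart_image c"
  unfolding overlap_def chart_image_def by blast

lemma transition_apply: "c \<in> A \<Longrightarrow> p \<in> fst c \<Longrightarrow> transition c d (snd c p) = snd d p"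
  by (simp add: transition_def chart_inv_left)

lemma tangent_coords_eq_transition:
  "tangent_coords A c p = frechet_derivative (transition (chart_at A p) c) (at (snd (chart_at A p) p))"
  by (simp add: tangent_coords_def transition_def)

lemma linear_tangent_coords:
  assumes "c \<in> A" "p \<in> fst c"
  shows "linear (tangent_coords A c p)"
  unfolding tangent_coords_eq_transition
  using smooth_on_linear_derivative[OF smooth_on_transition[OF chart_at_mem assms(1)]]
    mem_overlap[OF mem_chart_at assms(2)] by blast

text \<open>Chain rule for the coordinate change that starts in the chart singled out at
  \<open>p\<close> and passes through \<open>c\<close> to \<open>d\<close>.\<close>

lemma tangent_coords_change:
  assumes "c \<in> A" "d \<in> A" "p \<in> fst c" "p \<in> fst d"
  shows "tangent_coords A d p v = frechet_derivative (transition c d) (at (snd c p)) (tangent_coords A c p v)"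
proof -
  define e where "e = chart_at A p"
  have e: "e \<in> A" "p \<in> fst e" using chart_at_mem mem_chart_at by (auto simp: e_def)
  \<comment> \<open>The factorisation through \<open>c\<close> is valid over the triple overlap, an
    open set and hence enough to compare derivatives.\<close>
  let ?O = "snd e ` (fst e \<inter> (fst c \<inter> fst d))"
  have "frechet_derivative (transition e d) (at (snd e p))
      = frechet_derivative (transition c d \<circ> transition e c) (at (snd e p))"
  proof (rule frechet_derivative_cong_open)
    show "open ?O" using e assms by (intro open_image_chart open_Int open_chart_dom) auto
    show "snd e p \<in> ?O" using e assms by blast
    show "transition e d x = (transition c d \<circ> transition e c) x" if "x \<in> ?O" for x
      using that e assms by (auto simp: transition_apply)
  qed
  also have "\<dots> = frechet_derivative (transition c d) (at (transition e c (snd e p)))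
      \<circ> frechet_derivative (transition e c) (at (snd e p))"
  proof (rule frechet_derivative_compose)
    show "transition e c differentiable at (snd e p)"
      using smooth_on_differentiable[OF smooth_on_transition mem_overlap] e assms by blast
    show "transition c d differentiable at (transition e c (snd e p))"
      using smooth_on_differentiable[OF smooth_on_transition mem_overlap] e assms
      by (simp add: transition_apply)
  qed
  finally show ?thesis
    using e assms by (simp add: tangent_coords_eq_transition e_def[symmetric] transition_apply)
qed

lemma tangent_coords_chart_at: "tangent_coords A (chart_at A p) p v = v"
proof -
  let ?c = "chart_at A p"
  have "frechet_derivative (transition ?c ?c) (at (snd ?c p)) = frechet_derivative (\<lambda>x. x) (at (snd ?c p))"
    by (rule frechet_derivative_cong_open[OF open_chart_image[OF chart_at_mem[of p]]
          chart_mem[OF chart_at_mem mem_chart_at]])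
      (simp add: transition_def chart_inv_right[OF chart_at_mem])
  then show ?thesis
    by (simp add: tangent_coords_eq_transition frechet_derivative_eqI[OF has_derivative_ident])
qed

text \<open>The transformation law of vector fields, in the form that
  \<open>bracket_pushforward\<close> takes as a hypothesis.\<close>

lemma local_rep_transition:
  assumes "c \<in> A" "d \<in> A" "x \<in> overlap c d"
  shows "local_rep A d X (transition c d x) = frechet_derivative (transition c d) (at x) (local_rep A c X x)"
proof -
  obtain p where p: "p \<in> fst c" "p \<in> fst d" "x = snd c p"
    using assms(3) unfolding overlap_def by blast
  then show ?thesis
    using assms
    by (simp add: transition_apply local_rep_def chart_inv_left tangent_coords_change[OF assms(1,2) p(1,2)])
qed

lemma local_rep_chart_at: "local_rep A (chart_at A p) X (snd (chart_at A p) p) = X p"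
  by (simp add: local_rep_def chart_inv_left[OF chart_at_mem mem_chart_at] tangent_coords_chart_at)

lemma local_rep_add:
  assumes "c \<in> A" "x \<in> chart_image c"
  shows "local_rep A c (\<lambda>p. X p + Y p) x = local_rep A c X x + local_rep A c Y x"
  unfolding local_rep_def by (rule linear_add[OF linear_tangent_coords[OF assms(1) chart_inv_mem[OF assms]]])

lemma local_rep_diff:
  assumes "c \<in> A" "x \<in> chart_image c"
  shows "local_rep A c (\<lambda>p. X p - Y p) x = local_rep A c X x - local_rep A c Y x"
  unfolding local_rep_def by (rule linear_diff[OF linear_tangent_coords[OF assms(1) chart_inv_mem[OF assms]]])

lemma smooth_local_rep: "X \<in> vector_fields A \<Longrightarrow> c \<in> A \<Longrightarrow> smooth_on (chart_image c) (local_rep A c X)"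
  by (simp add: vector_fields_def)

lemma vector_fields_add:
  assumes "X \<in> vector_fields A" "Y \<in> vector_fields A"
  shows "(\<lambda>p. X p + Y p) \<in> vector_fields A"
proof -
  have "smooth_on (chart_image c) (local_rep A c (\<lambda>p. X p + Y p))" if "c \<in> A" for c
    by (rule smooth_on_cong[OF open_chart_image[OF that] local_rep_add[OF that, symmetric]])
      (auto intro!: smooth_on_add open_chart_image smooth_local_rep assms that)
  then show ?thesis by (simp add: vector_fields_def)
qed

lemma vector_fields_diff:
  assumes "X \<in> vector_fields A" "Y \<in> vector_fields A"
  shows "(\<lambda>p. X p - Y p) \<in> vector_fields A"
proof -
  have "smooth_on (chart_image c) (local_rep A c (\<lambda>p. X p - Y p))" if "c \<in> A" for c
    by (rule smooth_on_cong[OF open_chart_image[OF that] local_rep_diff[OF that, symmetric]])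
      (auto intro!: smooth_on_diff open_chart_image smooth_local_rep assms that)
  then show ?thesis by (simp add: vector_fields_def)
qed

section \<open>Lie brackets of vector fields on the manifold\<close>

lemma lie_bracket_eq_bracket:
  "lie_bracket A X Y p = bracket (local_rep A (chart_at A p) X) (local_rep A (chart_at A p) Y) (snd (chart_at A p) p)"
  by (simp add: lie_bracket_def bracket_def Let_def local_rep_chart_at)

text \<open>The bracket is defined at each point in the chart singled out there, which varies with
  the point. Naturality under the transition into \<open>c\<close> describes it in one fixed chart,
  and smoothness can be read off.\<close>

lemma local_rep_lie_bracket:
  assumes "X \<in> vector_fields A" "Y \<in> vector_fields A" "c \<in> A" "x \<in> chart_image c"
  shows "local_rep A c (lie_bracket A X Y) x = bracket (local_rep A c X) (local_rep A c Y) x"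
proof -
  define p where "p = chart_inv c x"
  define d where "d = chart_at A p"
  have p: "p \<in> fst c" "snd c p = x" using assms by (auto simp: p_def chart_inv_mem chart_inv_right)
  have d: "d \<in> A" "p \<in> fst d" using chart_at_mem mem_chart_at by (auto simp: d_def)
  have x: "transition d c (snd d p) = x" using d p by (simp add: transition_apply)
  have "bracket (local_rep A c X) (local_rep A c Y) (transition d c (snd d p))
     = frechet_derivative (transition d c) (at (snd d p)) (bracket (local_rep A d X) (local_rep A d Y) (snd d p))"
  proof (rule bracket_pushforward[OF open_overlap smooth_on_transition, of d c])
    show "snd d p \<in> overlap d c" using d p by (simp add: mem_overlap)
    show "smooth_on (overlap d c) (local_rep A d X)" "smooth_on (overlap d c) (local_rep A d Y)"
      using smooth_on_subset[OF smooth_local_rep overlap_subset] assms d by blast+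
    show "local_rep A c X differentiable at (transition d c (snd d p))"
      "local_rep A c Y differentiable at (transition d c (snd d p))"
      unfolding x using smooth_on_differentiable[OF smooth_local_rep] assms by blast+
  qed (use d assms in \<open>auto simp: local_rep_transition\<close>)
  then show ?thesis
    unfolding x by (simp add: local_rep_def[of A c "lie_bracket A X Y"] p_def[symmetric]
        lie_bracket_eq_bracket d_def[symmetric] tangent_coords_eq_transition)
qed

lemma lie_bracket_vector_fields:
  assumes "X \<in> vector_fields A" "Y \<in> vector_fields A"
  shows "lie_bracket A X Y \<in> vector_fields A"
proof -
  have "smooth_on (chart_image c) (local_rep A c (lie_bracket A X Y))" if "c \<in> A" for c
    by (rule smooth_on_cong[OF open_chart_image[OF that] local_rep_lie_bracket[OF assms that, symmetric]])
      (auto intro!: smooth_on_bracket open_chart_image smooth_local_rep assms that)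
  then show ?thesis by (simp add: vector_fields_def)
qed

lemma lie_bracket_commute: "lie_bracket A X Y p = - lie_bracket A Y X p"
  by (simp add: lie_bracket_def Let_def)

lemma lie_bracket_add_right:
  assumes "X \<in> vector_fields A" "Y \<in> vector_fields A" "Z \<in> vector_fields A"
  shows "lie_bracket A X (\<lambda>p. Y p + Z p) p = lie_bracket A X Y p + lie_bracket A X Z p"
proof -
  let ?c = "chart_at A p"
  have c: "?c \<in> A" "snd ?c p \<in> chart_image ?c"
    using chart_at_mem chart_mem[OF chart_at_mem mem_chart_at] by auto
  have "lie_bracket A X (\<lambda>p. Y p + Z p) p
      = bracket (local_rep A ?c X) (\<lambda>x. local_rep A ?c Y x + local_rep A ?c Z x) (snd ?c p)"
    unfolding lie_bracket_eq_bracket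
    by (rule bracket_cong[OF open_chart_image[OF c(1)] c(2)]) (simp_all add: local_rep_add c)
  also have "\<dots> = lie_bracket A X Y p + lie_bracket A X Z p"
    unfolding lie_bracket_eq_bracket
    by (rule bracket_add_right[OF smooth_local_rep smooth_local_rep smooth_local_rep]) (use assms c in auto)
  finally show ?thesis .
qed

text \<open>The outer bracket differentiates the inner one, so the inner one is replaced by its
  coordinate form on the whole chart image before \<open>bracket_jacobi\<close> applies.\<close>

lemma lie_bracket_jacobi:
  assumes "X \<in> vector_fields A" "Y \<in> vector_fields A" "Z \<in> vector_fields A"
  shows "lie_bracket A X (lie_bracket A Y Z) p + lie_bracket A Y (lie_bracket A Z X) p
     + lie_bracket A Z (lie_bracket A X Y) p = 0"
proof -
  let ?c = "chart_at A p"
  have c: "?c \<in> A" "snd ?c p \<in> chart_image ?c"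
    using chart_at_mem chart_mem[OF chart_at_mem mem_chart_at] by auto
  have *: "lie_bracket A X (lie_bracket A Y Z) p
      = bracket (local_rep A ?c X) (bracket (local_rep A ?c Y) (local_rep A ?c Z)) (snd ?c p)"
    if "Y \<in> vector_fields A" "Z \<in> vector_fields A" for X Y Z
    unfolding lie_bracket_eq_bracket[of X]
    by (rule bracket_cong[OF open_chart_image[OF c(1)] c(2)]) (simp_all add: local_rep_lie_bracket c that)
  show ?thesis
    unfolding *[OF assms(2,3)] *[OF assms(3,1)] *[OF assms(1,2)]
    by (rule bracket_jacobi[OF open_chart_image smooth_local_rep smooth_local_rep smooth_local_rep])
      (use assms c in auto)
qed

end

section \<open>The torsion of the canonical connection\<close>

locale almost_kaehler_canonical =
  fixes A :: "('m::{t2_space, second_countable_topology}, 'e::euclidean_space) chart set"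
    and g :: "'m \<Rightarrow> 'e \<Rightarrow> 'e \<Rightarrow> real"
    and J :: "'m \<Rightarrow> 'e \<Rightarrow> 'e"
    and \<omega> :: "'m \<Rightarrow> 'e \<Rightarrow> 'e \<Rightarrow> real"
    and D :: "('m \<Rightarrow> 'e) \<Rightarrow> ('m \<Rightarrow> 'e) \<Rightarrow> 'm \<Rightarrow> 'e"
  assumes almost_kaehler: "almost_kaehler A g J \<omega>"
    and canonical: "canonical_connection A g J D"

sublocale almost_kaehler_canonical \<subseteq> smooth_atlas
  using almost_kaehler by unfold_locales (simp add: almost_kaehler_def almost_hermitian_def)

context almost_kaehler_canonical
begin

abbreviation "V \<equiv> vector_fields A"
abbreviation "j \<equiv> endo_app J"
abbreviation "T \<equiv> torsion A D"

lemma hermitian: "almost_hermitian A g J \<omega>"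
  using almost_kaehler by (simp add: almost_kaehler_def)

lemma linear_J: "linear (J p)" and J_J [simp]: "J p (J p u) = - u" and j_V [simp]: "X \<in> V \<Longrightarrow> j X \<in> V"
  using hermitian by (simp_all add: almost_hermitian_def almost_complex_structure_def)

lemma J_simps [simp]: "J p (a + b) = J p a + J p b" "J p (a - b) = J p a - J p b" "J p (- a) = - J p a"
  using linear_J by (simp_all add: linear_add linear_diff linear_neg)

lemma j_apply: "j X p = J p (X p)"
  by (simp add: endo_app_def)

lemma bilinear_g: "bilinear (g p)" and g_commute: "g p u v = g p v u"
  and g_pos: "u \<noteq> 0 \<Longrightarrow> g p u u > 0" and g_J_J [simp]: "g p (J p u) (J p v) = g p u v"
  and \<omega>_eq: "\<omega> p u v = g p (J p u) v"
  using hermitian by (simp_all add: almost_hermitian_def riemannian_metric_def)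

lemma g_simps [simp]:
  "g p (a + b) c = g p a c + g p b c" "g p (a - b) c = g p a c - g p b c" "g p (- a) c = - g p a c"
  "g p c (a + b) = g p c a + g p c b" "g p c (a - b) = g p c a - g p c b" "g p c (- a) = - g p c a"
  using bilinear_g[of p]
  by (simp_all add: bilinear_ladd bilinear_lsub bilinear_lneg bilinear_radd bilinear_rsub bilinear_rneg)

lemma g_J_left: "g p (J p a) b = - g p a (J p b)"
  using g_J_J[of p a "J p b"] by simp

lemma linear_connection: "linear_connection A D"
  using canonical by (simp add: canonical_connection_def)

lemma D_V [simp]: "X \<in> V \<Longrightarrow> Y \<in> V \<Longrightarrow> D X Y \<in> V"
  using linear_connection by (simp add: linear_connection_def)

lemma D_add_right:
  "X \<in> V \<Longrightarrow> Y \<in> V \<Longrightarrow> Z \<in> V \<Longrightarrow> D X (\<lambda>p. Y p + Z p) = (\<lambda>p. D X Y p + D X Z p)"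
  using linear_connection unfolding linear_connection_def by blast

lemma D_j: "X \<in> V \<Longrightarrow> Y \<in> V \<Longrightarrow> D X (j Y) = j (D X Y)"
  using canonical unfolding canonical_connection_def covariant_deriv_endo_def
  by (auto simp: fun_eq_iff j_apply)

lemma D_metric:
  "X \<in> V \<Longrightarrow> Y \<in> V \<Longrightarrow> Z \<in> V \<Longrightarrow>
   vf_deriv A X (\<lambda>q. g q (Y q) (Z q)) p = g p (D X Y p) (Z p) + g p (Y p) (D X Z p)"
  using canonical unfolding canonical_connection_def covariant_deriv_metric_def
  by (auto simp: algebra_simps)

section \<open>Symmetries of the torsion\<close>

lemma lie_bracket_eq: "lie_bracket A X Y p = D X Y p - D Y X p - T X Y p"
  by (simp add: torsion_def)

lemma torsion_V [simp]: "X \<in> V \<Longrightarrow> Y \<in> V \<Longrightarrow> T X Y \<in> V"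
  unfolding torsion_def by (intro vector_fields_diff lie_bracket_vector_fields D_V)

lemma torsion_commute: "T X Y p = - T Y X p"
  using lie_bracket_commute[of X Y p] by (simp add: torsion_def)

lemma torsion_add_right:
  assumes "X \<in> V" "Y \<in> V" "Z \<in> V"
  shows "T X (\<lambda>p. Y p + Z p) p = T X Y p + T X Z p"
proof -
  have "D (\<lambda>p. Y p + Z p) X = (\<lambda>p. D Y X p + D Z X p)"
    using linear_connection assms unfolding linear_connection_def by blast
  then show ?thesis
    using assms by (simp add: torsion_def D_add_right lie_bracket_add_right)
qed

text \<open>The fields \<open>Y\<close> and \<open>j (j Y)\<close> add up to the zero field, on
  which \<open>T X\<close> vanishes by additivity.\<close>

lemma torsion_j_j_right:
  assumes "X \<in> V" "Y \<in> V"
  shows "T X (j (j Y)) p = - T X Y p"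
proof -
  have zero: "(\<lambda>p. Y p + j (j Y) p) = (\<lambda>p. 0)" by (simp add: j_apply)
  have "(\<lambda>p. 0::'e) \<in> V" using vector_fields_diff[OF assms(2,2)] by simp
  then have "T X (\<lambda>p. 0) p = 0" using torsion_add_right[OF assms(1), of "\<lambda>p. 0" "\<lambda>p. 0" p] by simp
  then show ?thesis
    using torsion_add_right[OF assms(1,2) j_V[OF j_V[OF assms(2)]], of p]
    unfolding zero by (simp add: eq_neg_iff_add_eq_0 add.commute)
qed

lemma torsion_j_j_left: "X \<in> V \<Longrightarrow> Y \<in> V \<Longrightarrow> T (j (j X)) Y p = - T X Y p"
  using torsion_commute[of _ Y p] torsion_j_j_right[of Y X p] by simp

lemma torsion_j_j: "X \<in> V \<Longrightarrow> Y \<in> V \<Longrightarrow> T (j X) (j Y) p = - T X Y p"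
  using canonical unfolding canonical_connection_def part_1_1_def
  by (metis (no_types, lifting) eq_neg_iff_add_eq_0 add.commute scaleR_eq_0_iff zero_neq_one divide_eq_0_iff zero_neq_numeral)

text \<open>Evaluate \<open>T (j X) (j (j Y))\<close> in two ways: by \<open>torsion_j_j\<close> and
  by cancelling the double \<open>j\<close>.\<close>

lemma torsion_j_swap:
  assumes "X \<in> V" "Y \<in> V"
  shows "T X (j Y) p = T (j X) Y p"
  using torsion_j_j[OF assms(1) j_V[OF assms(2)], of p] torsion_j_j_right[OF j_V[OF assms(1)] assms(2), of p]
  by simp

text \<open>\<open>U\<close> is given as a vector field so that it can serve as its own test
  field.\<close>

lemma nondegenerate:
  assumes "U \<in> V" "\<And>W. W \<in> V \<Longrightarrow> g p (U p) (W p) = 0"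
  shows "U p = 0"
  using assms(2)[OF assms(1)] g_pos[of "U p" p] by (cases "U p = 0") auto

text \<open>As \<open>D\<close> preserves \<open>g\<close> and \<open>J\<close>, the derivative
  terms of \<open>ext_deriv2\<close> cancel the \<open>D\<close>-terms of the brackets. Only the
  cyclic sum of \<omega>(T(X, Y), Z) is left, and skew-symmetry of \<open>J\<close> moves
  \<open>J\<close> to the other argument.\<close>

lemma fundamental_form_closed:
  assumes "X \<in> V" "Y \<in> V" "Z \<in> V"
  shows "g p (T X Y p) (J p (Z p)) + g p (T Y Z p) (J p (X p)) + g p (T Z X p) (J p (Y p)) = 0"
proof -
  have "ext_deriv2 A \<omega> X Y Z p = 0"
    using almost_kaehler assms unfolding almost_kaehler_def by blast
  moreover have "vf_deriv A X (\<lambda>q. \<omega> q (Y q) (Z q)) p = g p (D X Z p) (J p (Y p)) - g p (D X Y p) (J p (Z p))"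
    if "X \<in> V" "Y \<in> V" "Z \<in> V" for X Y Z
    using D_metric[OF that(1) j_V[OF that(2)] that(3), of p] that
    by (simp add: \<omega>_eq D_j j_apply g_J_left[of p "D X Y p"] g_commute[of p "J p (Y p)"])
  ultimately show ?thesis
    using assms torsion_commute[of Z X p]
    by (simp add: ext_deriv2_def lie_bracket_eq \<omega>_eq g_J_left[of p "D X Y p" for X Y] g_J_left[of p "T X Y p" for X Y])
qed

lemma torsion_antilinear_left:
  assumes "Y \<in> V" "Z \<in> V"
  shows "T (j Y) Z p = - J p (T Y Z p)"
proof -
  have *: "g p (T (j Y) Z p) (J p (X p)) = - g p (T Y Z p) (X p)" if X: "X \<in> V" for X
  proof -
    note V = X assms
    \<comment> \<open>Put a = g(T(jX, Y), JZ), b = g(T(jY, Z), JX), c = g(T(jZ, X), JY). The first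
      three instances say that a + c, a + b and b + c are g(T(Y, Z), X), g(T(Z, X), Y) and g(T(X,
      Y), Z). The fourth says that these add up to zero, so a + b + c = 0 and b = -(a + c).\<close>
    note e = fundamental_form_closed[of "j X" Y Z p] fundamental_form_closed[of X "j Y" Z p]
      fundamental_form_closed[of X Y "j Z" p] fundamental_form_closed[of "j X" "j Y" "j Z" p]
    show ?thesis
      using e V by (simp add: j_apply torsion_j_j_left torsion_j_swap)
  qed
  have "j (\<lambda>p. T (j Y) Z p) p - T Y Z p = 0"
  proof (rule nondegenerate[of "\<lambda>p. j (\<lambda>p. T (j Y) Z p) p - T Y Z p"])
    show "(\<lambda>p. j (\<lambda>p. T (j Y) Z p) p - T Y Z p) \<in> V"
      using assms by (intro vector_fields_diff) auto
    show "g p (j (\<lambda>p. T (j Y) Z p) p - T Y Z p) (W p) = 0" if "W \<in> V" for W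
      using *[OF that] by (simp add: j_apply g_J_left)
  qed
  then have "J p (J p (T (j Y) Z p)) = J p (T Y Z p)" by (simp add: j_apply)
  then show ?thesis by (simp add: minus_equation_iff[of "T (j Y) Z p"])
qed

lemma torsion_antilinear_right:
  "Y \<in> V \<Longrightarrow> Z \<in> V \<Longrightarrow> T Y (j Z) p = - J p (T Y Z p)"
  by (simp add: torsion_j_swap torsion_antilinear_left)

text \<open>On \<open>j X\<close>, \<open>j Y\<close>, \<open>j Z\<close> each term of the
  closedness identity gets one sign from the torsion and one from the square of
  \<open>J\<close>.\<close>

lemma torsion_cyclic:
  assumes "X \<in> V" "Y \<in> V" "Z \<in> V"
  shows "g p (T X Y p) (Z p) + g p (T Y Z p) (X p) + g p (T Z X p) (Y p) = 0"
  using fundamental_form_closed[of "j X" "j Y" "j Z" p] assms by (simp add: j_apply torsion_j_j)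

lemma quadruple: "v + v + v + v = 4 *\<^sub>R v" for v :: 'e
  by (rule euclidean_eqI) (simp add: inner_simps)

text \<open>The \<open>D\<close>-terms cancel because \<open>D\<close> commutes with
  \<open>J\<close>. By antilinearity each of the four brackets contributes one copy of
  \<open>T X Y\<close>.\<close>

lemma nijenhuis_eq_torsion:
  assumes "X \<in> V" "Y \<in> V"
  shows "nijenhuis A J X Y p = 4 *\<^sub>R T X Y p"
proof -
  have "nijenhuis A J X Y p = T X Y p + T X Y p + T X Y p + T X Y p"
    using assms
    by (simp add: nijenhuis_def lie_bracket_eq D_j j_apply torsion_antilinear_left torsion_antilinear_right)
  then show ?thesis by (simp add: quadruple)
qed

section \<open>Covariant derivative of the torsion and the first Bianchi identity\<close>

definition "DT X Y Z p = D X (T Y Z) p - T (D X Y) Z p - T Y (D X Z) p"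

definition "TT X Y Z = T (T X Y) Z"

text \<open>A \<open>J\<close> on \<open>X\<close> or \<open>Y\<close> passes through two antilinear
  slots and changes sign twice; on \<open>Z\<close> it passes through only one.\<close>

lemma TT_j:
  assumes "X \<in> V" "Y \<in> V" "Z \<in> V"
  shows "TT (j X) Y Z p = J p (TT X Y Z p)" "TT X (j Y) Z p = J p (TT X Y Z p)"
    "TT X Y (j Z) p = - J p (TT X Y Z p)"
proof -
  \<comment> \<open>The triple \<open>j\<close> encodes -J as an operation on vector fields, so that
    the antilinearity lemmas apply to the result.\<close>
  have "T (j X) Y = j (j (j (T X Y)))" "T X (j Y) = j (j (j (T X Y)))"
    using assms by (simp_all add: fun_eq_iff j_apply torsion_antilinear_left torsion_antilinear_right)
  then show "TT (j X) Y Z p = J p (TT X Y Z p)" "TT X (j Y) Z p = J p (TT X Y Z p)"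
    "TT X Y (j Z) p = - J p (TT X Y Z p)"
    using assms by (simp_all add: TT_def torsion_antilinear_left torsion_antilinear_right)
qed

text \<open>Since \<open>D\<close> commutes with \<open>J\<close>, differentiation preserves the
  antilinearity of \<open>T\<close> in its two arguments.\<close>

lemma DT_j:
  assumes "X \<in> V" "Y \<in> V" "Z \<in> V"
  shows "DT X (j Y) Z p = - J p (DT X Y Z p)" "DT X Y (j Z) p = - J p (DT X Y Z p)"
proof -
  have "T (j Y) Z = j (j (j (T Y Z)))" "T Y (j Z) = j (j (j (T Y Z)))"
    using assms by (simp_all add: fun_eq_iff j_apply torsion_antilinear_left torsion_antilinear_right)
  then show "DT X (j Y) Z p = - J p (DT X Y Z p)" "DT X Y (j Z) p = - J p (DT X Y Z p)"
    using assms by (simp_all add: DT_def D_j j_apply torsion_antilinear_left torsion_antilinear_right)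
qed

text \<open>The vector-valued form of \<open>curvature_tensor\<close>, before pairing with the
  fourth field.\<close>

definition "curvature_op X Y Z p = D X (D Y Z) p - D Y (D X Z) p - D (lie_bracket A X Y) Z p"

lemma curvature_op_V: "X \<in> V \<Longrightarrow> Y \<in> V \<Longrightarrow> Z \<in> V \<Longrightarrow> curvature_op X Y Z \<in> V"
  unfolding curvature_op_def by (intro vector_fields_diff D_V lie_bracket_vector_fields)

text \<open>Exchanging \<open>Y\<close> and \<open>Z\<close> in \<open>D X (D Y Z)\<close> costs a
  bracket and a torsion term. In the cyclic sum the second derivatives cancel, the double brackets
  vanish by Jacobi, and torsion terms remain.\<close>

lemma curvature_cyclic_sum:
  assumes "X \<in> V" "Y \<in> V" "Z \<in> V"
  shows "curvature_op X Y Z p + curvature_op Y Z X p + curvature_op Z X Y p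
    = DT X Y Z p + DT Y Z X p + DT Z X Y p + TT X Y Z p + TT Y Z X p + TT Z X Y p"
proof -
  \<comment> \<open>An equality of fields, because it is inserted as an argument of
    \<open>D X\<close> and of \<open>T X\<close>.\<close>
  have swap: "D Y Z = (\<lambda>p. D Z Y p + (lie_bracket A Y Z p + T Y Z p))" for Y Z
    by (simp add: lie_bracket_eq fun_eq_iff)
  have D: "D X (D Y Z) p = D X (D Z Y) p + (D X (lie_bracket A Y Z) p + D X (T Y Z) p)"
    if V: "X \<in> V" "Y \<in> V" "Z \<in> V" for X Y Z
  proof -
    have "D X (D Y Z) p = D X (\<lambda>p. D Z Y p + (lie_bracket A Y Z p + T Y Z p)) p"
      by (rule arg_cong[OF swap, of "\<lambda>U. D X U p"])
    then show ?thesis using V by (simp add: D_add_right vector_fields_add lie_bracket_vector_fields)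
  qed
  \<comment> \<open>The first two terms on the right belong to \<open>DT Y Z X\<close> and
    \<open>DT Z X Y\<close>.\<close>
  have T: "T X (lie_bracket A Y Z) p = - T (D Y Z) X p - T X (D Z Y) p + TT Y Z X p"
    if V: "X \<in> V" "Y \<in> V" "Z \<in> V" for X Y Z
  proof -
    have "T X (D Y Z) p = T X (\<lambda>p. D Z Y p + (lie_bracket A Y Z p + T Y Z p)) p"
      by (rule arg_cong[OF swap, of "\<lambda>U. T X U p"])
    also have "\<dots> = T X (D Z Y) p + (T X (lie_bracket A Y Z) p + T X (T Y Z) p)"
      using V by (simp add: torsion_add_right vector_fields_add lie_bracket_vector_fields)
    finally show ?thesis
      using torsion_commute[of X "D Y Z" p] torsion_commute[of X "T Y Z" p]
      by (simp add: TT_def algebra_simps)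
  qed
  have B: "D X (lie_bracket A Y Z) p - D (lie_bracket A Y Z) X p
      = lie_bracket A X (lie_bracket A Y Z) p + T X (lie_bracket A Y Z) p" for X Y Z
    by (simp add: torsion_def)
  show ?thesis
  \<comment> \<open>Taking components turns the vector identity into linear arithmetic over the
    reals.\<close>
  proof (rule euclidean_eqI)
    fix b :: 'e
    note i = arg_cong[where f = "\<lambda>v. v \<bullet> b"]
    show "(curvature_op X Y Z p + curvature_op Y Z X p + curvature_op Z X Y p) \<bullet> b
      = (DT X Y Z p + DT Y Z X p + DT Z X Y p + TT X Y Z p + TT Y Z X p + TT Z X Y p) \<bullet> b"
      using i[OF D[OF assms]] i[OF D[OF assms(2,3,1)]] i[OF D[OF assms(3,1,2)]]
        i[OF T[OF assms]] i[OF T[OF assms(2,3,1)]] i[OF T[OF assms(3,1,2)]]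
        i[OF B[of X Y Z]] i[OF B[of Y Z X]] i[OF B[of Z X Y]] i[OF lie_bracket_jacobi[OF assms, of p]]
      unfolding curvature_op_def DT_def inner_add_left inner_diff_left inner_minus_left inner_zero_left
      by linarith
  qed
qed

text \<open>Nondegeneracy of \<open>g\<close> removes the fourth argument from the assumed
  identity.\<close>

lemma bianchi_sum:
  assumes "first_bianchi A g D" "X \<in> V" "Y \<in> V" "Z \<in> V"
  shows "DT X Y Z p + DT Y Z X p + DT Z X Y p + TT X Y Z p + TT Y Z X p + TT Z X Y p = 0"
proof -
  let ?R = "\<lambda>p. curvature_op X Y Z p + curvature_op Y Z X p + curvature_op Z X Y p"
  have "?R p = 0"
  proof (rule nondegenerate[of ?R])
    show "?R \<in> V" using assms by (intro vector_fields_add curvature_op_V)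
    show "g p (?R p) (W p) = 0" if "W \<in> V" for W
      using assms that unfolding first_bianchi_def curvature_tensor_def curvature_op_def g_simps by blast
  qed
  then show ?thesis using curvature_cyclic_sum[OF assms(2-4)] by simp
qed

text \<open>\<open>TT X Y Z\<close> is complex linear in \<open>X\<close> and \<open>Y\<close> and antilinear in \<open>Z\<close>, while \<open>DT X Y Z\<close> is antilinear
  in \<open>Y\<close> and \<open>Z\<close>. So \<open>TT X Y Z\<close> is the only term of the cyclic sum which survives the projection to the
  part linear in \<open>X\<close> and \<open>Y\<close>.\<close>

lemma TT_eq_0:
  assumes "first_bianchi A g D" "X \<in> V" "Y \<in> V" "Z \<in> V"
  shows "TT X Y Z p = 0"
proof -
  let ?S = "\<lambda>X Y Z. DT X Y Z p + DT Y Z X p + DT Z X Y p + TT X Y Z p + TT Y Z X p + TT Z X Y p"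
  \<comment> \<open>This combination is four times the projection to the part that is complex linear
    in \<open>X\<close> and \<open>Y\<close>: a term antilinear in either argument cancels.\<close>
  have "?S X Y Z - J p (?S (j X) Y Z) - J p (?S X (j Y) Z) - ?S (j X) (j Y) Z
      = TT X Y Z p + TT X Y Z p + TT X Y Z p + TT X Y Z p"
    using assms(2-) by (simp only: TT_j DT_j j_V J_simps J_J) (simp add: algebra_simps)
  moreover have "?S X Y Z = 0" if "X \<in> V" "Y \<in> V" for X Y
    using bianchi_sum[OF assms(1) that assms(4)] .
  moreover have "J p 0 = 0" using linear_0[OF linear_J] .
  ultimately have "TT X Y Z p + TT X Y Z p + TT X Y Z p + TT X Y Z p = 0" using assms by simp
  then have "4 *\<^sub>R TT X Y Z p = 0" by (simp add: quadruple)
  then show ?thesis by simp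
qed

lemma torsion_eq_0:
  assumes "first_bianchi A g D" "X \<in> V" "Y \<in> V"
  shows "T X Y p = 0"
proof (rule ccontr)
  assume "T X Y p \<noteq> 0"
  have "T (T X Y) X p = 0" "T (T X Y) Y p = 0"
    using TT_eq_0[OF assms] assms by (simp_all add: TT_def)
  \<comment> \<open>With third field \<open>T X Y\<close>, the other two terms of the cyclic
    identity contain the torsions just shown to vanish, up to sign.\<close>
  then have "g p (T X Y p) (T X Y p) = 0"
    using torsion_cyclic[OF assms(2,3) torsion_V[OF assms(2,3)], of p] torsion_commute[of Y "T X Y" p]
      bilinear_lzero[OF bilinear_g] by simp
  then show False using g_pos[OF \<open>T X Y p \<noteq> 0\<close>] by (metis less_irrefl)
qed

end

theorem corollary1p2:
  fixes A :: "('m::{t2_space, second_countable_topology}, 'e::euclidean_space) chart set"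
    and g :: "'m \<Rightarrow> 'e \<Rightarrow> 'e \<Rightarrow> real"
    and J :: "'m \<Rightarrow> 'e \<Rightarrow> 'e"
    and \<omega> :: "'m \<Rightarrow> 'e \<Rightarrow> 'e \<Rightarrow> real"
    and D :: "('m \<Rightarrow> 'e) \<Rightarrow> ('m \<Rightarrow> 'e) \<Rightarrow> 'm \<Rightarrow> 'e"
  assumes "almost_kaehler A g J \<omega>"
    and "canonical_connection A g J D"
    and "first_bianchi A g D"
  shows "kaehler A g J \<omega>"
proof -
  interpret almost_kaehler_canonical A g J \<omega> D
    using assms by unfold_locales
  \<comment> \<open>Only integrability is left to check, and the Nijenhuis tensor is four times the
    vanishing torsion.\<close>
  show ?thesis
    using assms(1) by (simp add: kaehler_def integrable_structure_def nijenhuis_eq_torsion torsion_eq_0[OF assms(3)])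
qed

end
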